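(* Consider the real second-order discrete-time system $$x(k+1)=Ax(k)+b_u u(k)+b_d d(k),\qquad y(k)=C_m x(k),\qquad y_o(k)=c_o x(k),$$ with state $x(k)\in\mathbb{R}^2$, control input $u(k)\in\mathbb{R}$, disturbance $d(k)\in\mathbb{R}$, measurable output $y(k)\in\mathbb{R}^r$, regulated output $y_o(k)\in\mathbb{R}$, and given matrices $A\in\mathbb{R}^{2\times 2}$, $b_u,b_d\in\mathbb{R}^{2\times 1}$, $C_m\in\mathbb{R}^{r\times 2}$, $c_o\in\mathbb{R}^{1\times 2}$, where the disturbance is mismatched, i.e. $b_u^{T}b_d=0$. Suppose that $c_o b_u=0$, that the state is available, that $(A,b_u)$ is controllable, and that the disturbance is bounded and known. 1) Let $u_x(k)=Kx(k)$, where the state feedback gain $K\in\mathbb{R}^{1\times 2}$ is selected so that $A+b_uK$ is Schur. 2) Let $$u_d(k)=-I_1K_pb_d\,d(k)-I_2K_pb_d\,d(k+1),$$ where $K_p=\begin{bmatrix} b_u & (A+b_uK)b_u\end{bmatrix}^{-1}$, $I_1=\begin{bmatrix}1&0\end{bmatrix}$, $I_2=\begin{bmatrix}0&1\end{bmatrix}$. Then under the composite control law $u(k)=u_x(k)+u_d(k)$: (i) the closed-loop system is bounded-input-bounded-state (BIBS) stable; (ii) the known disturbance is immediately and completely eliminated from the regulated output $y_o$.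
   Context: A square real matrix is Schur if all its eigenvalues lie strictly inside the unit circle of the complex plane. The pair $(A,b_u)$ is controllable if $\begin{bmatrix} b_u & Ab_u\end{bmatrix}$ has rank $2$. BIBS stable means that bounded disturbances produce bounded state sequences. "Immediately and completely eliminated from the regulated output" means that the regulated output $y_o(k)$ is unaffected by the disturbance at every instant, rather than only in the steady state. "Known" means that the values $d(k)$ and $d(k+1)$ may be used by the controller at time $k$.
   Formalization: In (ii), outputs are compared for runs with equal state and equal disturbance value at the starting instant, since d(0) could not be cancelled beforehand; for any d(0), y_o is shown to be the undisturbed output from an initial state shifted along b_u. *)

theory Defs
  imports "HOL-Analysis.Analysis"
begin

definition complex_eigenvalue :: "real^'n^'n \<Rightarrow> complex \<Rightarrow> bool" where
  "complex_eigenvalue A z \<longleftrightarrow> (\<exists>v. v \<noteq> 0 \<and> map_matrix complex_of_real A *v v = z *s v)"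

definition schur :: "real^'n^'n \<Rightarrow> bool" where
  "schur A \<longleftrightarrow> (\<forall>z. complex_eigenvalue A z \<longrightarrow> cmod z < 1)"

text \<open>The matrix with columns \<open>v\<close> and \<open>w\<close>; \<open>vector\<close> lists the rows, hence the transpose.\<close>

definition columns2 :: "real^2 \<Rightarrow> real^2 \<Rightarrow> real^2^2" where
  "columns2 v w = transpose (vector [v, w])"

definition controllable :: "real^2^2 \<Rightarrow> real^2 \<Rightarrow> bool" where
  "controllable A b \<longleftrightarrow> rank (columns2 b (A *v b)) = 2"

text \<open>
  Single columns (\<open>b\<^sub>u\<close>, \<open>b\<^sub>d\<close>) and single rows (\<open>c\<^sub>o\<close>, \<open>K\<close>) are vectors in \<open>real^2\<close>.
  The product of a row and a column is the inner product, and the product of the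
  column \<open>b\<close> and the row \<open>K\<close> is the 2 by 2 matrix below.
\<close>

definition closed_loop_matrix :: "real^2^2 \<Rightarrow> real^2 \<Rightarrow> real^2 \<Rightarrow> real^2^2" where
  "closed_loop_matrix A b K = A + (columnvector b :: real^1^2) ** rowvector K"

definition gain_Kp :: "real^2^2 \<Rightarrow> real^2 \<Rightarrow> real^2 \<Rightarrow> real^2^2" where
  "gain_Kp A b\<^sub>u K = matrix_inv (columns2 b\<^sub>u (closed_loop_matrix A b\<^sub>u K *v b\<^sub>u))"

definition plant ::
  "real^2^2 \<Rightarrow> real^2 \<Rightarrow> real^2 \<Rightarrow> real^2^'r \<Rightarrow> real^2 \<Rightarrow> (nat \<Rightarrow> real) \<Rightarrow>
   (nat \<Rightarrow> real) \<Rightarrow> (nat \<Rightarrow> real^2) \<Rightarrow> (nat \<Rightarrow> real^'r) \<Rightarrow> (nat \<Rightarrow> real) \<Rightarrow> bool" where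
  "plant A b\<^sub>u b\<^sub>d C\<^sub>m c\<^sub>o u d x y y\<^sub>o \<longleftrightarrow>
     (\<forall>k. x (k + 1) = A *v x k + u k *\<^sub>R b\<^sub>u + d k *\<^sub>R b\<^sub>d \<and>
          y k = C\<^sub>m *v x k \<and>
          y\<^sub>o k = c\<^sub>o \<bullet> x k)"

definition feedback_control :: "real^2 \<Rightarrow> (nat \<Rightarrow> real^2) \<Rightarrow> nat \<Rightarrow> real" where
  "feedback_control K x k = K \<bullet> x k"

text \<open>The rows \<open>I\<^sub>1\<close> and \<open>I\<^sub>2\<close> are \<open>axis 1 1\<close> and \<open>axis 2 1\<close>.\<close>

definition disturbance_control ::
  "real^2^2 \<Rightarrow> real^2 \<Rightarrow> real^2 \<Rightarrow> real^2 \<Rightarrow> (nat \<Rightarrow> real) \<Rightarrow> nat \<Rightarrow> real" where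
  "disturbance_control A b\<^sub>u b\<^sub>d K d k =
     - (axis 1 1 \<bullet> (gain_Kp A b\<^sub>u K *v b\<^sub>d)) * d k
     - (axis 2 1 \<bullet> (gain_Kp A b\<^sub>u K *v b\<^sub>d)) * d (k + 1)"

definition closed_loop ::
  "real^2^2 \<Rightarrow> real^2 \<Rightarrow> real^2 \<Rightarrow> real^2^'r \<Rightarrow> real^2 \<Rightarrow> real^2 \<Rightarrow>
   (nat \<Rightarrow> real) \<Rightarrow> (nat \<Rightarrow> real^2) \<Rightarrow> (nat \<Rightarrow> real^'r) \<Rightarrow> (nat \<Rightarrow> real) \<Rightarrow> bool" where
  "closed_loop A b\<^sub>u b\<^sub>d C\<^sub>m c\<^sub>o K d x y y\<^sub>o \<longleftrightarrow>
     plant A b\<^sub>u b\<^sub>d C\<^sub>m c\<^sub>o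
       (\<lambda>k. feedback_control K x k + disturbance_control A b\<^sub>u b\<^sub>d K d k) d x y y\<^sub>o"

text \<open>
  The next two notions apply to a system given as the relation between its disturbance,
  state, measured output and regulated output sequences.
\<close>

definition bibs_stable ::
  "((nat \<Rightarrow> real) \<Rightarrow> (nat \<Rightarrow> real^2) \<Rightarrow> (nat \<Rightarrow> real^'r) \<Rightarrow> (nat \<Rightarrow> real) \<Rightarrow> bool) \<Rightarrow> bool" where
  "bibs_stable S \<longleftrightarrow>
     (\<forall>d x y y\<^sub>o. S d x y y\<^sub>o \<longrightarrow> bounded (range d) \<longrightarrow> bounded (range x))"

text \<open>
  No change of the disturbance after an instant \<open>k\<^sub>0\<close> is ever visible in the regulated
  output, not even transiently. The two runs must have the same current sample at \<open>k\<^sub>0\<close>, not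
  only the same state: a controller that uses the next sample acts against \<open>d k\<^sub>0\<close> already
  at instant \<open>k\<^sub>0 - 1\<close>, so this sample belongs to the initial data of the run from \<open>k\<^sub>0\<close>.
\<close>

definition disturbance_eliminated ::
  "((nat \<Rightarrow> real) \<Rightarrow> (nat \<Rightarrow> real^2) \<Rightarrow> (nat \<Rightarrow> real^'r) \<Rightarrow> (nat \<Rightarrow> real) \<Rightarrow> bool) \<Rightarrow> bool" where
  "disturbance_eliminated S \<longleftrightarrow>
     (\<forall>d x y y\<^sub>o d' x' y' y\<^sub>o' k\<^sub>0.
        S d x y y\<^sub>o \<longrightarrow> S d' x' y' y\<^sub>o' \<longrightarrow> bounded (range d) \<longrightarrow> bounded (range d') \<longrightarrow>
        x k\<^sub>0 = x' k\<^sub>0 \<longrightarrow> d k\<^sub>0 = d' k\<^sub>0 \<longrightarrow> (\<forall>k\<ge>k\<^sub>0. y\<^sub>o k = y\<^sub>o' k))"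

end

theory Submission
  imports Defs
begin

text \<open>
  Put \<open>M = A + b\<^sub>u K\<close> and \<open>\<beta> = I\<^sub>2 K\<^sub>p b\<^sub>d\<close>. The gain \<open>K\<^sub>p\<close> splits
  \<open>b\<^sub>d = \<alpha> b\<^sub>u + \<beta> M b\<^sub>u\<close>, and so the shifted state \<open>z k = x k + \<beta> d k b\<^sub>u\<close> obeys the
  undisturbed recurrence \<open>z (k + 1) = M z k\<close>. As \<open>c\<^sub>o b\<^sub>u = 0\<close>, the regulated output is
  \<open>c\<^sub>o z k\<close>, which does not see the disturbance. The orbits of \<open>M\<close> are bounded, since by
  Cayley-Hamilton each coordinate satisfies a linear recurrence whose characteristic roots
  lie in the open unit disc.
\<close>

lemma complex_eigenvalueI_det:
  fixes A :: "real^'n^'n"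
  assumes "det (map_matrix complex_of_real A - mat z) = 0"
  shows "complex_eigenvalue A z"
proof -
  let ?B = "map_matrix complex_of_real A - mat z"
  have "\<not> invertible ?B"
    using assms by (simp add: invertible_det_nz)
  then obtain v where v: "v \<noteq> 0" "?B *v v = 0"
    by (metis invertible_left_inverse matrix_left_invertible_ker)
  have "mat z *v v = z *s v"
    by (simp add: vec_eq_iff matrix_vector_mult_def mat_def if_distrib
        if_distribR cong: if_cong)
  with v have "map_matrix complex_of_real A *v v = z *s v"
    by (simp add: matrix_vector_mult_diff_rdistrib)
  with v show ?thesis
    unfolding complex_eigenvalue_def by blast
qed

text \<open>The quadratic in \<open>z\<close> is the characteristic polynomial of \<open>A\<close>,
  written with trace and determinant.\<close>

lemma complex_eigenvalue_2I:
  fixes A :: "real^2^2"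
  assumes "z\<^sup>2 - of_real (A$1$1 + A$2$2) * z + of_real (det A) = 0"
  shows "complex_eigenvalue A z"
proof (rule complex_eigenvalueI_det)
  show "det (map_matrix complex_of_real A - mat z) = 0"
    using assms by (simp add: det_2 mat_def map_matrix_def power2_eq_square algebra_simps)
qed

lemma matrix_2_cayley_hamilton:
  fixes A :: "'a::comm_ring_1^2^2"
  shows "A *v (A *v v) = (A$1$1 + A$2$2) *s (A *v v) - det A *s v"
  by (simp add: vec_eq_iff forall_2 matrix_vector_mult_def sum_2 det_2 algebra_simps)

text \<open>Meant for splitting the characteristic polynomial: \<open>a\<close> and \<open>b\<close>
  are the roots of \<open>X^2 - t X + p\<close>, listed with multiplicity, so a double root needs no
  separate case.\<close>

lemma sum_product_solution:
  fixes t p :: complex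
  obtains a b where "a + b = t" "a * b = p"
proof -
  define r where "r = csqrt (t\<^sup>2 - 4 * p)"
  have "(t + r) / 2 * ((t - r) / 2) = (t\<^sup>2 - r\<^sup>2) / 4"
    by (simp add: power2_eq_square field_simps)
  also have "\<dots> = p"
    by (simp add: r_def)
  finally have "(t + r) / 2 * ((t - r) / 2) = p" .
  moreover have "(t + r) / 2 + (t - r) / 2 = t"
    by (simp add: field_simps)
  ultimately show thesis
    using that by blast
qed

text \<open>The ball of this radius is invariant: \<open>B / (1 - norm a)\<close> is the fixed point
  of the map sending \<open>r\<close> to \<open>norm a * r + B\<close>, and no larger radius grows
  under that map.\<close>

lemma first_order_recurrence_bounded:
  fixes s :: "nat \<Rightarrow> 'a::real_normed_algebra"
  assumes rec: "\<And>k. s (Suc k) = a * s k + w k"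
    and a: "norm a < 1" and w: "\<And>k. norm (w k) \<le> B"
  shows "norm (s k) \<le> max (norm (s 0)) (B / (1 - norm a))"
proof (induction k)
  case (Suc k)
  let ?R = "max (norm (s 0)) (B / (1 - norm a))"
  have "norm (s (Suc k)) \<le> norm a * norm (s k) + norm (w k)"
    unfolding rec by (meson add_mono norm_mult_ineq norm_triangle_le order_refl order_trans)
  also have "\<dots> \<le> norm a * ?R + B"
    using Suc w by (intro add_mono mult_left_mono) auto
  also have "\<dots> \<le> norm a * ?R + (1 - norm a) * ?R"
    using a by (subst (2) mult.commute) (simp flip: pos_divide_le_eq)
  also have "\<dots> = ?R"
    by (simp flip: distrib_right)
  finally show ?case .
qed simp

text \<open>With E the shift of sequences, the recurrence factors as (E - a)(E - b) s = 0, so the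
  first-order bound is applied twice: to \<open>w = (E - a) s\<close> with ratio \<open>b\<close>,
  then to \<open>s\<close> with ratio \<open>a\<close> and bounded input \<open>w\<close>. Nothing
  is divided by \<open>a - b\<close>, so equal roots are covered.\<close>

lemma second_order_recurrence_bounded:
  fixes s :: "nat \<Rightarrow> 'a::real_normed_field"
  assumes rec: "\<And>k. s (Suc (Suc k)) = (a + b) * s (Suc k) - a * b * s k"
    and a: "norm a < 1" and b: "norm b < 1"
  shows "\<exists>R. \<forall>k. norm (s k) \<le> R"
proof -
  define w where "w k = s (Suc k) - a * s k" for k
  have w: "w (Suc k) = b * w k + 0" for k
    by (simp add: w_def rec algebra_simps)
  have "norm (w k) \<le> max (norm (w 0)) (0 / (1 - norm b))" for k
    by (rule first_order_recurrence_bounded[where s = w and w = "\<lambda>_. 0", OF w b]) simp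
  moreover have "s (Suc k) = a * s k + w k" for k
    by (simp add: w_def)
  ultimately show ?thesis
    using first_order_recurrence_bounded a by blast
qed

lemma schur_2_orbit_bounded:
  fixes A :: "real^2^2"
  assumes schur: "schur A" and rec: "\<And>k. z (Suc k) = A *v z k"
  shows "bounded (range z)"
proof -
  obtain a b :: complex where ab: "a + b = of_real (A$1$1 + A$2$2)" "a * b = of_real (det A)"
    using sum_product_solution by blast
  \<comment> \<open>With trace \<open>a + b\<close> and determinant \<open>a * b\<close>, the
    polynomial is (X - a)(X - b).\<close>
  have "complex_eigenvalue A a" "complex_eigenvalue A b"
    by (rule complex_eigenvalue_2I, simp only: ab[symmetric] power2_eq_square algebra_simps, simp)+
  then have cmod: "cmod a < 1" "cmod b < 1"
    using schur by (simp_all add: schur_def)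
  have comp: "\<exists>R. \<forall>k. \<bar>z k $ i\<bar> \<le> R" for i
  proof -
    have "z (Suc (Suc k)) $ i = (A$1$1 + A$2$2) * z (Suc k) $ i - det A * z k $ i" for k
      by (simp add: rec matrix_2_cayley_hamilton flip: distrib_right)
    \<comment> \<open>The roots may be non-real, so the real coordinate is viewed as a complex
      sequence.\<close>
    then have "complex_of_real (z (Suc (Suc k)) $ i) =
        (a + b) * of_real (z (Suc k) $ i) - a * b * of_real (z k $ i)" for k
      unfolding ab by simp
    from second_order_recurrence_bounded[where s = "\<lambda>k. complex_of_real (z k $ i)", OF this cmod]
    show ?thesis by simp
  qed
  then obtain R where R: "\<And>i k. \<bar>z k $ i\<bar> \<le> R i"
    by metis
  have "norm (z k) \<le> (\<Sum>i\<in>UNIV. R i)" for k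
    by (rule order_trans[OF norm_le_l1_cart]) (rule sum_mono, rule R)
  then show ?thesis
    by (auto simp: bounded_iff)
qed

lemma columns2_mult_vec: "columns2 v w *v c = c$1 *\<^sub>R v + c$2 *\<^sub>R w"
  by (simp add: vec_eq_iff columns2_def transpose_def matrix_vector_mult_def sum_2 vector_2)

lemma det_columns2: "det (columns2 v w) = v$1 * w$2 - w$1 * v$2"
  by (simp add: columns2_def det_2 transpose_def vector_2)

lemma closed_loop_matrix_mult_vec:
  "closed_loop_matrix A b K *v v = A *v v + (K \<bullet> v) *\<^sub>R b"
  by (simp add: vec_eq_iff closed_loop_matrix_def matrix_vector_mult_def matrix_matrix_mult_def
      columnvector_def rowvector_def sum_2 inner_vec_def algebra_simps)

lemma controllable_iff_det: "controllable A b \<longleftrightarrow> det (columns2 b (A *v b)) \<noteq> 0"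
  using rank_bound[of "columns2 b (A *v b)"]
  by (auto simp: controllable_def det_eq_0_rank)

lemma matrix_mult_matrix_inv:
  assumes "invertible A"
  shows "A ** matrix_inv A = mat 1"
  using someI_ex[OF assms[unfolded invertible_def]] by (simp add: matrix_inv_def)

lemma gain_Kp_decomposition:
  fixes A :: "real^2^2" and b\<^sub>u K v :: "real^2"
  assumes "controllable A b\<^sub>u"
  defines "g \<equiv> gain_Kp A b\<^sub>u K *v v"
  shows "v = g$1 *\<^sub>R b\<^sub>u + g$2 *\<^sub>R (closed_loop_matrix A b\<^sub>u K *v b\<^sub>u)"
proof -
  let ?P = "columns2 b\<^sub>u (closed_loop_matrix A b\<^sub>u K *v b\<^sub>u)"
  \<comment> \<open>Feedback adds only a multiple of the first column to the second, so
    controllability makes \<open>?P\<close> invertible for every \<open>K\<close>.\<close>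
  have "det ?P = det (columns2 b\<^sub>u (A *v b\<^sub>u))"
    by (simp add: det_columns2 closed_loop_matrix_mult_vec algebra_simps)
  with assms have "invertible ?P"
    by (simp add: controllable_iff_det invertible_det_nz)
  then have "v = ?P *v (matrix_inv ?P *v v)"
    by (simp add: matrix_vector_mul_assoc matrix_mult_matrix_inv)
  then show ?thesis
    by (simp add: g_def gain_Kp_def columns2_mult_vec)
qed

lemma closed_loop_shifted_state:
  fixes A :: "real^2^2" and b\<^sub>u b\<^sub>d c\<^sub>o K :: "real^2" and C\<^sub>m :: "real^2^'r"
  assumes "controllable A b\<^sub>u"
    and "c\<^sub>o \<bullet> b\<^sub>u = 0"
    and loop: "closed_loop A b\<^sub>u b\<^sub>d C\<^sub>m c\<^sub>o K d x y y\<^sub>o"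
  defines "z \<equiv> \<lambda>k. x k + (d k * (axis 2 1 \<bullet> (gain_Kp A b\<^sub>u K *v b\<^sub>d))) *\<^sub>R b\<^sub>u"
  shows "z (Suc k) = closed_loop_matrix A b\<^sub>u K *v z k" and "y\<^sub>o k = c\<^sub>o \<bullet> z k"
proof -
  let ?M = "closed_loop_matrix A b\<^sub>u K"
  define g where "g = gain_Kp A b\<^sub>u K *v b\<^sub>d"
  have b\<^sub>d: "b\<^sub>d = g$1 *\<^sub>R b\<^sub>u + g$2 *\<^sub>R (?M *v b\<^sub>u)"
    unfolding g_def by (rule gain_Kp_decomposition[OF assms(1)])
  have x: "x (Suc k) = A *v x k + (K \<bullet> x k - g$1 * d k - g$2 * d (Suc k)) *\<^sub>R b\<^sub>u + d k *\<^sub>R b\<^sub>d"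
    using loop by (simp add: closed_loop_def plant_def feedback_control_def
        disturbance_control_def inner_axis' algebra_simps flip: g_def)
  \<comment> \<open>The term \<open>g$1 * d k\<close> of the control cancels the
    \<open>b\<^sub>u\<close> part of \<open>b\<^sub>d\<close>. What remains is \<open>?M\<close>
    applied to the shift at \<open>k\<close>, minus the shift at \<open>Suc k\<close>; moving the
    latter to the left yields the recurrence for \<open>z\<close>.\<close>
  have "x (Suc k) = ?M *v x k + (d k * g$2) *\<^sub>R (?M *v b\<^sub>u) - (g$2 * d (Suc k)) *\<^sub>R b\<^sub>u"
    unfolding x by (subst b\<^sub>d) (simp add: closed_loop_matrix_mult_vec[of _ _ _ "x k"] algebra_simps)
  then show "z (Suc k) = ?M *v z k"
    by (simp add: z_def inner_axis' matrix_vector_right_distrib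
        matrix_vector_mult_scaleR algebra_simps flip: g_def)
  show "y\<^sub>o k = c\<^sub>o \<bullet> z k"
    using assms(2) loop by (simp add: z_def closed_loop_def plant_def inner_add_right)
qed

theorem theorem1:
  fixes A :: "real^2^2" and b\<^sub>u b\<^sub>d c\<^sub>o K :: "real^2" and C\<^sub>m :: "real^2^'r"
  assumes mismatched: "b\<^sub>u \<bullet> b\<^sub>d = 0"
    and output_decoupled: "c\<^sub>o \<bullet> b\<^sub>u = 0"
    and controllable: "controllable A b\<^sub>u"
    and feedback_gain: "schur (closed_loop_matrix A b\<^sub>u K)"
  shows "bibs_stable (closed_loop A b\<^sub>u b\<^sub>d C\<^sub>m c\<^sub>o K) \<and>
    disturbance_eliminated (closed_loop A b\<^sub>u b\<^sub>d C\<^sub>m c\<^sub>o K) \<and>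
    (\<forall>d x y y\<^sub>o. closed_loop A b\<^sub>u b\<^sub>d C\<^sub>m c\<^sub>o K d x y y\<^sub>o \<longrightarrow> bounded (range d) \<longrightarrow>
           (\<exists>x' y'. closed_loop A b\<^sub>u b\<^sub>d C\<^sub>m c\<^sub>o K (\<lambda>k. 0) x' y' y\<^sub>o \<and>
              x' 0 = x 0 + (d 0 * (axis 2 1 \<bullet> (gain_Kp A b\<^sub>u K *v b\<^sub>d))) *\<^sub>R b\<^sub>u))"
proof (intro conjI allI impI)
  let ?\<beta> = "axis 2 1 \<bullet> (gain_Kp A b\<^sub>u K *v b\<^sub>d)"
  let ?S = "closed_loop A b\<^sub>u b\<^sub>d C\<^sub>m c\<^sub>o K"
  note shifted = closed_loop_shifted_state[OF controllable output_decoupled]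
  show "bibs_stable ?S"
    unfolding bibs_stable_def
  proof (intro allI impI)
    fix d x y y\<^sub>o
    assume loop: "?S d x y y\<^sub>o" and "bounded (range d)"
    then obtain D where D: "\<And>k. \<bar>d k\<bar> \<le> D"
      by (auto simp: bounded_iff)
    have "bounded (range (\<lambda>k. x k + (d k * ?\<beta>) *\<^sub>R b\<^sub>u))"
      by (intro schur_2_orbit_bounded[OF feedback_gain] shifted(1)[OF loop])
    then obtain R where R: "\<And>k. norm (x k + (d k * ?\<beta>) *\<^sub>R b\<^sub>u) \<le> R"
      by (auto simp: bounded_iff)
    \<comment> \<open>The state is the bounded orbit minus the shift, and the shift is bounded
      because \<open>d\<close> is.\<close>
    have "norm (x k) \<le> R + D * norm (?\<beta> *\<^sub>R b\<^sub>u)" for k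
    proof -
      have "norm (x k) \<le> norm (x k + (d k * ?\<beta>) *\<^sub>R b\<^sub>u) + norm (d k *\<^sub>R ?\<beta> *\<^sub>R b\<^sub>u)"
        using norm_triangle_ineq4[of "x k + (d k * ?\<beta>) *\<^sub>R b\<^sub>u" "(d k * ?\<beta>) *\<^sub>R b\<^sub>u"] by simp
      also have "\<dots> \<le> R + D * norm (?\<beta> *\<^sub>R b\<^sub>u)"
        unfolding norm_scaleR[of "d k"] by (intro add_mono R mult_right_mono D norm_ge_zero)
      finally show ?thesis .
    qed
    then show "bounded (range x)"
      by (auto simp: bounded_iff)
  qed
  show "disturbance_eliminated ?S"
    unfolding disturbance_eliminated_def
  proof (intro allI impI)
    fix d x y y\<^sub>o d' x' y' y\<^sub>o' and k\<^sub>0 k :: nat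
    assume loop: "?S d x y y\<^sub>o" and loop': "?S d' x' y' y\<^sub>o'"
      and init: "x k\<^sub>0 = x' k\<^sub>0" "d k\<^sub>0 = d' k\<^sub>0" and "k\<^sub>0 \<le> k"
    \<comment> \<open>Equal states and equal samples at \<open>k\<^sub>0\<close> make the shifted
      states equal there; from then on both follow the same recurrence, whatever the later
      disturbances.\<close>
    from \<open>k\<^sub>0 \<le> k\<close> have "x k + (d k * ?\<beta>) *\<^sub>R b\<^sub>u = x' k + (d' k * ?\<beta>) *\<^sub>R b\<^sub>u"
      by (induction k rule: dec_induct) (simp_all add: init shifted(1)[OF loop] shifted(1)[OF loop'])
    then show "y\<^sub>o k = y\<^sub>o' k"
      by (simp add: shifted(2)[OF loop] shifted(2)[OF loop'])
  qed
  fix d x y y\<^sub>o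
  assume loop: "?S d x y y\<^sub>o"
  \<comment> \<open>The shifted state is itself the undisturbed run: for zero disturbance the
    feedforward control vanishes and the loop reduces to the recurrence of
    \<open>?z\<close>.\<close>
  let ?z = "\<lambda>k. x k + (d k * ?\<beta>) *\<^sub>R b\<^sub>u"
  have "?S (\<lambda>k. 0) ?z (\<lambda>k. C\<^sub>m *v ?z k) y\<^sub>o"
    using shifted[OF loop] by (simp add: closed_loop_def plant_def feedback_control_def
        disturbance_control_def closed_loop_matrix_mult_vec)
  then show "\<exists>x' y'. ?S (\<lambda>k. 0) x' y' y\<^sub>o \<and> x' 0 = x 0 + (d 0 * ?\<beta>) *\<^sub>R b\<^sub>u"
    by blast
qed

end
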